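(* Let $b$ be a positive integer. Let $\mathcal M_1=\{4,4\}_{b,0}$ be the regular map on the torus $\mathbb C/b\mathbb Z[i]$ and $\mathcal M_2=\{4,4\}_{b,b}$ the regular map on the torus $\mathbb C/(b+bi)\mathbb Z[i]$, both induced by the tessellation of $\mathbb C$ by unit squares with vertices at the Gaussian integers $\mathbb Z[i]$. Then the pattern of a mirror of a reflection of $\mathcal M_1$ is $(\mathbf{01})^b$, $(\mathbf{02})^b$ or $(\mathbf{12})^b$, and the pattern of a mirror of a reflection of $\mathcal M_2$ is $(\mathbf{01})^{2b}$, $(\mathbf{02})^b$ or $(\mathbf{12})^{2b}$.
   Context: The geometric points of a map are its vertices (denoted $\mathbf 0$), edge-centres (denoted $\mathbf 1$) and face-centres (denoted $\mathbf 2$). A reflection of the map is an orientation-reversing involutive automorphism; its fixed curves (mirrors) pass through geometric points, and the pattern of a mirror is the cyclic sequence of geometric points met along it, written $(\ell)^K$ to mean the word $\ell$ repeated $K$ times around the closed mirror (here $\ell$ is the minimal repeating block, and $K$ is the link index). *)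

theory Defs
  imports "HOL-Complex_Analysis.Complex_Analysis"
begin

definition gauss_ints :: "complex set" where
  "gauss_ints = {z. Re z \<in> \<int> \<and> Im z \<in> \<int>}"

definition lattice_b0 :: "nat \<Rightarrow> complex set" where
  "lattice_b0 b = (\<lambda>z. of_nat b * z) ` gauss_ints"

definition lattice_bb :: "nat \<Rightarrow> complex set" where
  "lattice_bb b = (\<lambda>z. (of_nat b + of_nat b * \<i>) * z) ` gauss_ints"

text \<open>For an additive subgroup \<open>L\<close> of the complex plane, the points of the torus are the
  cosets of \<open>L\<close>; the torus carries the quotient topology.\<close>

definition tpoint :: "complex set \<Rightarrow> complex \<Rightarrow> complex set" where
  "tpoint L z = {w. w - z \<in> L}"

definition torus :: "complex set \<Rightarrow> complex set set" where
  "torus L = range (tpoint L)"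

definition torus_topology :: "complex set \<Rightarrow> complex set topology" where
  "torus_topology L = topology (\<lambda>U. U \<subseteq> torus L \<and> open (tpoint L -` U))"

lemma openin_torus_topology:
  "openin (torus_topology L) U \<longleftrightarrow> U \<subseteq> torus L \<and> open (tpoint L -` U)"
proof -
  have "istopology (\<lambda>U. U \<subseteq> torus L \<and> open (tpoint L -` U))"
    unfolding istopology_def by (auto simp: vimage_Int vimage_Union intro!: open_Int open_UN)
  then show ?thesis
    unfolding torus_topology_def by (simp add: topology_inverse')
qed

lemma topspace_torus_topology [simp]: "topspace (torus_topology L) = torus L"
proof
  show "topspace (torus_topology L) \<subseteq> torus L"
    unfolding topspace_def by (auto simp: openin_torus_topology)
  have "tpoint L -` torus L = UNIV"
    by (auto simp: torus_def)
  then have "openin (torus_topology L) (torus L)"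
    by (simp add: openin_torus_topology)
  then show "torus L \<subseteq> topspace (torus_topology L)"
    by (rule openin_subset)
qed

lemma quotient_map_tpoint: "quotient_map euclidean (torus_topology L) (tpoint L)"
  unfolding quotient_map_def
  by (auto simp: openin_torus_topology torus_def vimage_def)

text \<open>The cells of the map that the tessellation of the plane by unit squares induces on the
  torus. Edges and faces are open cells. The map is determined by \<open>L\<close>, so \<open>L\<close> stands for it
  below: \<open>lattice_b0 b\<close> gives \<open>{4,4}\<close> with index \<open>(b,0)\<close> and \<open>lattice_bb b\<close> gives \<open>{4,4}\<close> with
  index \<open>(b,b)\<close>.\<close>

definition vertices :: "complex set \<Rightarrow> complex set set" where
  "vertices L = tpoint L ` gauss_ints"

definition edges :: "complex set \<Rightarrow> complex set set set" where
  "edges L = {tpoint L ` open_segment v (v + u) | v u. v \<in> gauss_ints \<and> u \<in> {1, \<i>}}"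

definition faces :: "complex set \<Rightarrow> complex set set set" where
  "faces L = {tpoint L ` box v (v + (1 + \<i>)) | v. v \<in> gauss_ints}"

definition edge_centres :: "complex set \<Rightarrow> complex set set" where
  "edge_centres L = {tpoint L (midpoint v (v + u)) | v u. v \<in> gauss_ints \<and> u \<in> {1, \<i>}}"

definition face_centres :: "complex set \<Rightarrow> complex set set" where
  "face_centres L = {tpoint L (midpoint v (v + (1 + \<i>))) | v. v \<in> gauss_ints}"

definition geometric_points :: "complex set \<Rightarrow> complex set set" where
  "geometric_points L = vertices L \<union> edge_centres L \<union> face_centres L"

datatype point_kind = P0 | P1 | P2

definition kind :: "complex set \<Rightarrow> complex set \<Rightarrow> point_kind" where
  "kind L p = (if p \<in> vertices L then P0 else if p \<in> edge_centres L then P1 else P2)"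

text \<open>(Anti)conformality is expressed in the charts given by local inverses of \<open>tpoint L\<close>.
  A map automorphism is a conformal or anticonformal bijection of the torus permuting the cells;
  the anticonformal ones are those that reverse the orientation.\<close>

definition conformal :: "complex set \<Rightarrow> (complex set \<Rightarrow> complex set) \<Rightarrow> bool" where
  "conformal L f \<longleftrightarrow>
     (\<forall>z. \<exists>r>0. \<exists>g. g holomorphic_on ball z r \<and>
        (\<forall>w\<in>ball z r. f (tpoint L w) = tpoint L (g w)))"

definition anticonformal :: "complex set \<Rightarrow> (complex set \<Rightarrow> complex set) \<Rightarrow> bool" where
  "anticonformal L f \<longleftrightarrow>
     (\<forall>z. \<exists>r>0. \<exists>g. (cnj \<circ> g) holomorphic_on ball z r \<and>
        (\<forall>w\<in>ball z r. f (tpoint L w) = tpoint L (g w)))"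

definition map_automorphism :: "complex set \<Rightarrow> (complex set \<Rightarrow> complex set) \<Rightarrow> bool" where
  "map_automorphism L f \<longleftrightarrow>
     bij_betw f (torus L) (torus L) \<and> (conformal L f \<or> anticonformal L f) \<and>
     f ` vertices L = vertices L \<and> (`) f ` edges L = edges L \<and> (`) f ` faces L = faces L"

definition map_reflection :: "complex set \<Rightarrow> (complex set \<Rightarrow> complex set) \<Rightarrow> bool" where
  "map_reflection L f \<longleftrightarrow>
     map_automorphism L f \<and> anticonformal L f \<and> (\<forall>p\<in>torus L. f (f p) = p)"

definition mirrors :: "complex set \<Rightarrow> (complex set \<Rightarrow> complex set) \<Rightarrow> complex set set set" where
  "mirrors L f = connected_components_of (subtopology (torus_topology L) {p \<in> torus L. f p = p})"

definition traverses :: "complex set \<Rightarrow> complex set set \<Rightarrow> (real \<Rightarrow> complex set) \<Rightarrow> bool" where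
  "traverses L C \<gamma> \<longleftrightarrow>
     continuous_map (top_of_set {0..1}) (torus_topology L) \<gamma> \<and>
     \<gamma> ` {0..1} = C \<and> \<gamma> 0 = \<gamma> 1 \<and> inj_on \<gamma> {0..<1}"

text \<open>The list is empty if infinitely many parameters meet geometric points, which never
  happens for a curve carrying a pattern in the sense below.\<close>

definition word_along :: "complex set \<Rightarrow> (real \<Rightarrow> complex set) \<Rightarrow> point_kind list" where
  "word_along L \<gamma> =
     map (\<lambda>t. kind L (\<gamma> t)) (sorted_list_of_set {t \<in> {0..<1}. \<gamma> t \<in> geometric_points L})"

text \<open>A cyclic sequence is a word up to the choice of starting point and direction.\<close>

definition cyclic_class :: "'a list \<Rightarrow> 'a list set" where
  "cyclic_class w = {u. \<exists>k. u = rotate k w \<or> u = rotate k (rev w)}"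

definition primitive :: "'a list \<Rightarrow> bool" where
  "primitive w \<longleftrightarrow> (\<forall>u n. w = concat (replicate n u) \<longrightarrow> n = 1)"

text \<open>\<open>has_pattern L C l K\<close>: the closed curve \<open>C\<close> has pattern \<open>(l)\<^sup>K\<close>, with \<open>l\<close> the minimal
  repeating block and \<open>K\<close> the link index.\<close>

definition has_pattern ::
    "complex set \<Rightarrow> complex set set \<Rightarrow> point_kind list \<Rightarrow> nat \<Rightarrow> bool" where
  "has_pattern L C l K \<longleftrightarrow>
     K > 0 \<and> primitive l \<and> (\<exists>\<gamma>. traverses L C \<gamma>) \<and>
     (\<forall>\<gamma>. traverses L C \<gamma> \<longrightarrow> word_along L \<gamma> \<in> cyclic_class (concat (replicate K l)))"

end

theory Submission
  imports Defs
begin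

text \<open>The derivatives of local lifts of a reflection form an elliptic entire function, so by
  Liouville's theorem a reflection is induced by an affine map \<open>z \<mapsto> u * cnj z + c\<close>; preservation
  of vertices and involutivity force \<open>u \<in> {1, -1, \<i>, -\<i>}\<close> and \<open>c\<close> to be a Gaussian integer.
  Choose a basis \<open>v, w\<close> of the lattice with \<open>v\<close> a positive multiple of \<open>d \<in> {1, \<i>, 1 \<plusminus> \<i>}\<close>, a
  direction fixed by \<open>z \<mapsto> u * cnj z\<close>. The characters of the torus given by the two coordinates
  show that a mirror is the image of a line in direction \<open>v\<close>, and that it is a circle whose
  parametrisations all agree up to rotation, orientation and monotone reparametrisation. If
  \<open>v = K * d\<close>, the mirror meets geometric points of two alternating kinds at steps of \<open>d / 2\<close>,
  hence \<open>2 * K\<close> of them.\<close>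

section \<open>Traversals of a circle\<close>

lemma cis_2pi_eq_iff: "cis (2 * pi * x) = cis (2 * pi * y) \<longleftrightarrow> x - y \<in> \<int>"
proof -
  have "cis (2 * pi * x) = cis (2 * pi * y) \<longleftrightarrow> cis (2 * pi * (x - y)) = 1"
    by (simp add: right_diff_distrib flip: cis_divide)
  also have "\<dots> \<longleftrightarrow> (\<exists>n::int. 2 * pi * (x - y) = 2 * pi * n)"
    using cos_one_2pi_int[of "2 * pi * (x - y)"] cos_one_sin_zero[of "2 * pi * (x - y)"]
    by (auto simp: complex_eq_iff mult_ac)
  also have "\<dots> \<longleftrightarrow> x - y \<in> \<int>"
    by (auto simp: Ints_def)
  finally show ?thesis .
qed

text \<open>A lift of a simple closed parametrisation of the unit circle to the real line is
  injective, hence monotone, and by the intermediate value theorem it advances by exactly one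
  turn. The sign \<open>e\<close> is the orientation.\<close>

lemma circle_parametrisation_lift:
  fixes g :: "real \<Rightarrow> complex"
  assumes cont: "continuous_on {0..1} g" and unit: "\<And>t. t \<in> {0..1} \<Longrightarrow> norm (g t) = 1"
    and closed: "g 0 = g 1" and inj: "inj_on g {0..<1}"
  obtains \<phi> :: "real \<Rightarrow> real" and e :: real where
    "e = 1 \<or> e = -1" "\<And>t. t \<in> {0..1} \<Longrightarrow> g t = cis (2 * pi * (e * \<phi> t))"
    "strict_mono_on {0..<1} \<phi>" "\<phi> ` {0..<1} = {\<phi> 0..<\<phi> 0 + 1}"
proof -
  \<comment> \<open>The interval is contractible, so the nowhere vanishing \<open>g\<close> has a
    continuous logarithm; its imaginary part in units of full turns is the lift.\<close>
  obtain h where conth: "continuous_on {0..1} h" and h: "\<And>t. t \<in> {0..1} \<Longrightarrow> g t = exp (h t)"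
  proof (rule continuous_logarithm_on_contractible[OF cont])
    show "contractible {0..1::real}"
      by (simp add: convex_imp_contractible)
    show "g z \<noteq> 0" if "z \<in> {0..1}" for z
      using unit[OF that] by auto
  qed blast
  define \<phi>\<^sub>0 where "\<phi>\<^sub>0 t = Im (h t) / (2 * pi)" for t
  have g0: "g t = cis (2 * pi * \<phi>\<^sub>0 t)" if "t \<in> {0..1}" for t
  proof -
    have "exp (Re (h t)) = 1"
      using unit[OF that] h[OF that] by simp
    then show ?thesis
      using h[OF that] by (simp add: exp_eq_polar \<phi>\<^sub>0_def)
  qed
  \<comment> \<open>The orientation is read off at the midpoint, so that the corrected lift
    \<open>\<phi>\<close> always starts upwards; only the increasing case remains.\<close>
  define e :: real where "e = (if \<phi>\<^sub>0 0 < \<phi>\<^sub>0 (1/2) then 1 else -1)"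
  define \<phi> where "\<phi> t = e * \<phi>\<^sub>0 t" for t
  have e: "e = 1 \<or> e = -1" and ee: "e * (e * x) = x" for x
    by (auto simp: e_def)
  have g: "g t = cis (2 * pi * (e * \<phi> t))" if "t \<in> {0..1}" for t
    using g0[OF that] by (simp add: \<phi>_def ee)
  have g_eq: "g s = g t \<longleftrightarrow> \<phi> s - \<phi> t \<in> \<int>" if "s \<in> {0..1}" "t \<in> {0..1}" for s t
  proof -
    have "g s = g t \<longleftrightarrow> e * (\<phi> s - \<phi> t) \<in> \<int>"
      using that by (simp add: g cis_2pi_eq_iff right_diff_distrib)
    also have "\<dots> \<longleftrightarrow> \<phi> s - \<phi> t \<in> \<int>"
      using e minus_in_Ints_iff[of "\<phi> s - \<phi> t"] by auto
    finally show ?thesis .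
  qed
  have g_inj: "s = t" if "g s = g t" "s \<in> {0..<1}" "t \<in> {0..<1}" for s t
    using inj that by (auto dest: inj_onD)
  have cont\<phi>: "continuous_on {0..1} \<phi>"
    unfolding \<phi>_def \<phi>\<^sub>0_def by (intro continuous_intros conth) auto
  have half: "\<phi> 0 < \<phi> (1/2)"
  proof -
    have "\<phi> 0 \<noteq> \<phi> (1/2)"
      using g_inj[of 0 "1/2"] g_eq[of 0 "1/2"] by auto
    then show ?thesis
      by (auto simp: \<phi>_def e_def split: if_splits)
  qed
  \<comment> \<open>If both ends had the same lift, the path would go up to
    \<open>\<phi> (1/2)\<close> and come back. The intermediate height \<open>y\<close> would then
    be attained once in each half, against injectivity of \<open>g\<close>.\<close>
  have ne: "\<phi> 0 \<noteq> \<phi> 1"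
  proof
    assume eq: "\<phi> 0 = \<phi> 1"
    define y where "y = (\<phi> 0 + \<phi> (1/2)) / 2"
    have y: "\<phi> 0 < y" "y < \<phi> (1/2)"
      using half by (auto simp: y_def)
    obtain s where s: "0 \<le> s" "s \<le> 1/2" "\<phi> s = y"
      using IVT'[of \<phi> 0 y "1/2"] y continuous_on_subset[OF cont\<phi>, of "{0..1/2}"] by force
    obtain t where t: "1/2 \<le> t" "t \<le> 1" "\<phi> t = y"
      using IVT2'[of \<phi> 1 y "1/2"] y eq continuous_on_subset[OF cont\<phi>, of "{1/2..1}"] by force
    have "s \<noteq> 1/2" "t \<noteq> 1"
      using s t y eq by fastforce+
    then show False
      using g_inj[of s t] g_eq[of s t] s t by auto
  qed
  have inj\<phi>: "inj_on \<phi> {0..1}"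
  proof (rule inj_onI)
    fix s t :: real assume st: "s \<in> {0..1}" "t \<in> {0..1}" "\<phi> s = \<phi> t"
    then have "g s = g t"
      using g_eq by auto
    moreover have "0 \<in> {0..<1::real}" "s \<in> {0..<1} \<or> s = 1" "t \<in> {0..<1} \<or> t = 1"
      using st by auto
    ultimately have "s = t \<or> (s = 0 \<and> t = 1) \<or> (s = 1 \<and> t = 0)"
      using g_inj closed by metis
    then show "s = t"
      using st ne by metis
  qed
  \<comment> \<open>Betweenness for a continuous injection: at parameter \<open>1/2\<close> it gives
    \<open>\<phi> 0 < \<phi> 1\<close>, and at \<open>t\<close> it then places
    \<open>\<phi> t\<close> between these two values.\<close>
  have mid: "\<phi> 0 < \<phi> t \<and> \<phi> t < \<phi> 1" if "0 < t" "t < 1" for t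
    using continuous_inj_imp_mono[OF _ _ cont\<phi> inj\<phi>, of "1/2"]
      continuous_inj_imp_mono[OF _ _ cont\<phi> inj\<phi>, of t] half that by auto
  have mono: "\<phi> s < \<phi> t" if "0 \<le> s" "s < t" "t \<le> 1" for s t
  proof (cases "s = 0 \<or> t = 1")
    case True
    then show ?thesis
      using mid[of s] mid[of t] mid[of "1/2"] that by (cases "s = 0"; cases "t = 1") auto
  next
    case False
    have "{0..t} \<subseteq> {0..1}"
      using that by auto
    then have "(\<phi> 0 < \<phi> s \<and> \<phi> s < \<phi> t) \<or> (\<phi> t < \<phi> s \<and> \<phi> s < \<phi> 0)"
      using continuous_inj_imp_mono[of 0 s t \<phi>] False that
        continuous_on_subset[OF cont\<phi>] inj_on_subset[OF inj\<phi>] by auto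
    then show ?thesis
      using mid[of s] False that by auto
  qed
  have "\<phi> 1 - \<phi> 0 \<in> \<int>"
    using g_eq[of 1 0] closed by simp
  then obtain n :: int where n: "\<phi> 1 - \<phi> 0 = n"
    by (auto elim: Ints_cases)
  have "n > 0"
    using mono[of 0 1] n by simp
  \<comment> \<open>A path making two or more turns would reach \<open>\<phi> 0 + 1\<close> at an
    interior parameter and so revisit \<open>g 0\<close> too early.\<close>
  moreover have "n < 2"
  proof (rule ccontr)
    assume "\<not> n < 2"
    then have "\<phi> 1 \<ge> \<phi> 0 + 2"
      using n by linarith
    then obtain t where t: "0 \<le> t" "t \<le> 1" "\<phi> t = \<phi> 0 + 1"
      using IVT'[of \<phi> 0 "\<phi> 0 + 1" 1] cont\<phi> by auto
    moreover have "t \<noteq> 0" "t \<noteq> 1"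
      using t \<open>\<phi> 1 \<ge> \<phi> 0 + 2\<close> by auto
    ultimately show False
      using g_inj[of t 0] g_eq[of t 0] by auto
  qed
  ultimately have one: "\<phi> 1 = \<phi> 0 + 1"
    using n by simp
  have "\<phi> ` {0..<1} = {\<phi> 0..<\<phi> 0 + 1}"
  proof (intro equalityI subsetI)
    fix y assume "y \<in> \<phi> ` {0..<1}"
    then obtain t where "0 \<le> t" "t < 1" "y = \<phi> t"
      by auto
    then show "y \<in> {\<phi> 0..<\<phi> 0 + 1}"
      using mono[of t 1] mono[of 0 t] one by (cases "t = 0") auto
  next
    fix y assume y: "y \<in> {\<phi> 0..<\<phi> 0 + 1}"
    then obtain t where t: "0 \<le> t" "t \<le> 1" "\<phi> t = y"
      using IVT'[of \<phi> 0 y 1] cont\<phi> one by auto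
    moreover have "t \<noteq> 1"
      using t y one by auto
    ultimately show "y \<in> \<phi> ` {0..<1}"
      by force
  qed
  moreover have "strict_mono_on {0..<1} \<phi>"
    using mono by (auto simp: strict_mono_on_def)
  ultimately show ?thesis
    using that[OF e g] by blast
qed

section \<open>Words and patterns of closed curves\<close>

lemma sorted_list_of_set_image_strict_mono:
  fixes f :: "nat \<Rightarrow> 'a :: linorder"
  assumes "strict_mono_on {..<n} f"
  shows "sorted_list_of_set (f ` {..<n}) = map f [0..<n]"
proof -
  have "sorted_wrt (<) (map f [0..<n])"
    using assms by (auto simp: sorted_wrt_map sorted_wrt_iff_nth_less strict_mono_on_def)
  then have "sorted_list_of_set (set (map f [0..<n])) = map f [0..<n]"
    by (intro sorted_list_of_set.idem_if_sorted_distinct) (auto simp: strict_sorted_iff)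
  then show ?thesis
    by (simp add: atLeast0LessThan)
qed

lemma concat_replicate_pair:
  "concat (replicate K [a, b]) = map (\<lambda>j. if even j then a else b) [0..<2 * K]"
proof (induction K)
  case (Suc K)
  have "concat (replicate (Suc K) [a, b]) = concat (replicate K [a, b]) @ [a, b]"
    by (simp only: replicate_Suc flip: replicate_append_same) simp
  then show ?case
    using Suc by simp
qed simp

text \<open>The length \<open>2 * K\<close> is even, so reducing an index modulo the length keeps
  its parity. Hence only the parity of the offset \<open>m\<close> matters, and a rotation by 0 or 1
  suffices.\<close>

lemma alternating_word_rotation:
  fixes m :: int
  shows "map (\<lambda>j. if even (m + int j) then a else b) [0..<2 * K] =
    rotate (nat (m mod 2)) (concat (replicate K [a, b]))"
proof (rule nth_equalityI)
  fix i assume i: "i < length (map (\<lambda>j. if even (m + int j) then a else b) [0..<2 * K])"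
  have "even ((nat (m mod 2) + i) mod (2 * K)) \<longleftrightarrow> even (nat (m mod 2) + i)"
    by (simp add: dvd_mod_iff)
  also have "\<dots> \<longleftrightarrow> even (m + int i)"
    by (auto simp: even_nat_iff)
  finally show "map (\<lambda>j. if even (m + int j) then a else b) [0..<2 * K] ! i =
      rotate (nat (m mod 2)) (concat (replicate K [a, b])) ! i"
    using i by (simp add: concat_replicate_pair nth_rotate)
qed (simp add: concat_replicate_pair)

text \<open>Comparing lengths leaves only one or two copies of \<open>u\<close>, and two copies
  would force \<open>a = b\<close>. This certifies that the block in a pattern is minimal.\<close>

lemma primitive_pair:
  assumes "a \<noteq> b"
  shows "primitive [a, b]"
  unfolding primitive_def
proof (intro allI impI)
  fix u :: "'a list" and n assume eq: "[a, b] = concat (replicate n u)"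
  have len: "n * length u = 2"
    using arg_cong[OF eq, of length] by (simp add: length_concat sum_list_replicate)
  then have "n dvd 2"
    by (metis dvd_triv_left)
  then have "n \<le> 2"
    by (rule dvd_imp_le) simp
  moreover have "n \<noteq> 0"
    using len by (metis mult_0 zero_neq_numeral)
  moreover have "n \<noteq> 2"
  proof
    assume "n = 2"
    then have "length u = 1" "[a, b] = u @ u"
      using len eq by (auto simp: numeral_2_eq_2)
    then show False
      using assms by (cases u) auto
  qed
  ultimately show "n = 1"
    by linarith
qed

text \<open>\<open>\<omega>\<close> identifies the curve with the unit circle, so that every other traversal of the curve
  is a reparametrisation of \<open>c\<close> up to orientation. Reversing the orientation preserves the
  parity of the index \<open>j\<close>, so only rotations of the word occur.\<close>

lemma has_pattern_alternating:
  fixes c :: "real \<Rightarrow> complex set"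
  assumes K: "K > 0" and AB: "A \<noteq> B"
    and \<omega>: "continuous_map (torus_topology L) euclidean \<omega>" "\<And>s. \<omega> (c s) = cis (2 * pi * s)"
    and c: "continuous_map euclidean (torus_topology L) c"
    and period: "\<And>s t. s - t \<in> \<int> \<Longrightarrow> c s = c t"
    and geom: "\<And>s. c s \<in> geometric_points L \<longleftrightarrow> 2 * real K * s \<in> \<int>"
    and kind: "\<And>j::int. kind L (c (j / (2 * K))) = (if even j then A else B)"
  shows "has_pattern L (range c) [A, B] K"
proof -
  have "traverses L (range c) c"
    unfolding traverses_def
  proof (intro conjI)
    show "continuous_map (top_of_set {0..1}) (torus_topology L) c"
      using c by (rule continuous_map_from_subtopology)
    show "c ` {0..1} = range c"
    proof (intro equalityI subsetI)
      fix p assume "p \<in> range c"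
      then obtain s where "p = c s"
        by auto
      also have "c s = c (frac s)"
        by (rule period) (simp add: frac_def)
      finally show "p \<in> c ` {0..1}"
        using frac_ge_0[of s] frac_lt_1[of s] by force
    qed auto
    show "c 0 = c 1"
      by (rule period) auto
    show "inj_on c {0..<1}"
    proof (rule inj_onI)
      fix s t :: real assume st: "s \<in> {0..<1}" "t \<in> {0..<1}" "c s = c t"
      then have "cis (2 * pi * s) = cis (2 * pi * t)"
        using \<omega>(2) by metis
      then have "s - t \<in> \<int>"
        by (simp add: cis_2pi_eq_iff)
      then show "s = t"
        using st Ints_nonzero_abs_less1[of "s - t"] by auto
    qed
  qed
  moreover have "word_along L \<gamma> \<in> cyclic_class (concat (replicate K [A, B]))"
    if "traverses L (range c) \<gamma>" for \<gamma>
  proof -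
    from that have cont: "continuous_map (top_of_set {0..1}) (torus_topology L) \<gamma>"
      and img: "\<gamma> ` {0..1} = range c" and closed: "\<gamma> 0 = \<gamma> 1" and inj: "inj_on \<gamma> {0..<1}"
      by (auto simp: traverses_def)
    have c_inj: "p = q" if "p \<in> range c" "q \<in> range c" "\<omega> p = \<omega> q" for p q
      using that period by (auto simp: \<omega>(2) cis_2pi_eq_iff)
    have \<gamma>_in: "\<gamma> t \<in> range c" if "t \<in> {0..1}" for t
      using img that by blast
    obtain \<phi> and e :: real where e: "e = (1::real) \<or> e = -1"
      and lift: "\<And>t. t \<in> {0..1} \<Longrightarrow> (\<omega> \<circ> \<gamma>) t = cis (2 * pi * (e * \<phi> t))"
      and mono: "strict_mono_on {0..<1} \<phi>" and onto: "\<phi> ` {0..<1} = {\<phi> 0..<\<phi> 0 + 1}"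
    proof (rule circle_parametrisation_lift[of "\<omega> \<circ> \<gamma>"])
      show "continuous_on {0..1} (\<omega> \<circ> \<gamma>)"
        using continuous_map_compose[OF cont \<omega>(1)] by simp
      show "norm ((\<omega> \<circ> \<gamma>) t) = 1" if "t \<in> {0..1}" for t
        using \<gamma>_in[OF that] by (auto simp: \<omega>(2))
      show "(\<omega> \<circ> \<gamma>) 0 = (\<omega> \<circ> \<gamma>) 1"
        by (simp add: closed)
      show "inj_on (\<omega> \<circ> \<gamma>) {0..<1}"
      proof (rule comp_inj_on[OF inj inj_onI])
        fix p q assume "p \<in> \<gamma> ` {0..<1}" "q \<in> \<gamma> ` {0..<1}" "\<omega> p = \<omega> q"
        moreover have "\<gamma> ` {0..<1} \<subseteq> range c"
          unfolding img[symmetric] by (rule image_mono) auto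
        ultimately show "p = q"
          by (intro c_inj) (auto dest: subsetD)
      qed
    qed blast
    have \<gamma>: "\<gamma> t = c (e * \<phi> t)" if "t \<in> {0..1}" for t
      using c_inj[OF \<gamma>_in[OF that], of "c (e * \<phi> t)"] lift[OF that] by (simp add: \<omega>(2))
    \<comment> \<open>The geometric points sit at the multiples of \<open>1 / (2 * K)\<close>.
      \<open>m\<close> numbers the first multiple not below \<open>\<phi> 0\<close>, the
      \<open>x j\<close> are the \<open>2 * K\<close> consecutive multiples in the half-open turn
      starting there, and \<open>\<tau> j\<close> is the time at which the lift reaches
      \<open>x j\<close>.\<close>
    define m where "m = \<lceil>2 * K * \<phi> 0\<rceil>"
    define x where "x j = (m + int j) / (2 * K)" for j :: nat
    define \<tau> where "\<tau> j = inv_into {0..<1} \<phi> (x j)" for j :: nat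
    have x: "x j \<in> {\<phi> 0..<\<phi> 0 + 1}" if "j < 2 * K" for j
    proof -
      have "real j + 1 \<le> 2 * K"
        using that by linarith
      then have "2 * K * \<phi> 0 \<le> m + int j" "m + int j < 2 * K * \<phi> 0 + 2 * K"
        unfolding m_def by linarith+
      then show ?thesis
        using K by (simp add: x_def field_simps)
    qed
    have \<tau>: "\<tau> j \<in> {0..<1}" "\<phi> (\<tau> j) = x j" if "j < 2 * K" for j
      using x[OF that] onto inv_into_into[of "x j" \<phi> "{0..<1}"] f_inv_into_f[of "x j" \<phi> "{0..<1}"]
      unfolding \<tau>_def by auto
    have "{t \<in> {0..<1}. \<gamma> t \<in> geometric_points L} = \<tau> ` {..<2 * K}"
    proof (intro equalityI subsetI)
      fix t assume "t \<in> {t \<in> {0..<1}. \<gamma> t \<in> geometric_points L}"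
      then have t: "t \<in> {0..<1}" "2 * K * (e * \<phi> t) \<in> \<int>"
        using \<gamma>[of t] geom by auto
      have "2 * K * \<phi> t \<in> \<int>"
        using t(2) e minus_in_Ints_iff[of "2 * K * \<phi> t"] by auto
      then obtain n :: int where n: "2 * K * \<phi> t = n"
        by (auto elim: Ints_cases)
      have "\<phi> t \<in> {\<phi> 0..<\<phi> 0 + 1}"
        using onto t(1) by auto
      then have "2 * K * \<phi> 0 \<le> 2 * K * \<phi> t" "2 * K * \<phi> t < 2 * K * (\<phi> 0 + 1)"
        using K by (simp_all del: distrib_left_numeral)
      then have "m \<le> n" "n < m + 2 * K"
        unfolding m_def n by (auto simp: ceiling_le_iff algebra_simps) linarith
      then obtain j where j: "n = m + int j" "j < 2 * K"
        using zle_iff_zadd by auto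
      have "\<phi> t = x j"
        using n j K by (simp add: x_def field_simps)
      then have "t = \<tau> j"
        unfolding \<tau>_def using inv_into_f_f[OF strict_mono_on_imp_inj_on[OF mono] t(1)] by simp
      then show "t \<in> \<tau> ` {..<2 * K}"
        using j by blast
    next
      fix t assume "t \<in> \<tau> ` {..<2 * K}"
      then obtain j where j: "j < 2 * K" "t = \<tau> j"
        by auto
      have "2 * K * (e * x j) = e * of_int (m + int j)"
        using K by (simp add: x_def)
      also have "\<dots> \<in> \<int>"
        using e Ints_of_int[of "m + int j"] by (metis Ints_minus mult_1 mult_minus1)
      finally show "t \<in> {t \<in> {0..<1}. \<gamma> t \<in> geometric_points L}"
        using \<tau>[OF j(1)] \<gamma>[of t] geom j by simp
    qed
    moreover have "strict_mono_on {..<2 * K} \<tau>"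
    proof (rule strict_mono_onI)
      fix i j assume ij: "i \<in> {..<2 * K}" "j \<in> {..<2 * K}" "i < j"
      then have "\<phi> (\<tau> i) < \<phi> (\<tau> j)"
        using K \<tau>(2)[of i] \<tau>(2)[of j] by (simp add: x_def divide_strict_right_mono)
      then show "\<tau> i < \<tau> j"
        using strict_mono_on_less[OF mono \<tau>(1)[of i] \<tau>(1)[of j]] ij by simp
    qed
    ultimately have "word_along L \<gamma> = map (\<lambda>j. kind L (\<gamma> (\<tau> j))) [0..<2 * K]"
      by (simp add: word_along_def sorted_list_of_set_image_strict_mono)
    also have "\<dots> = map (\<lambda>j. if even (m + int j) then A else B) [0..<2 * K]"
    proof (rule map_cong)
      fix j assume "j \<in> set [0..<2 * K]"
      then have j: "j < 2 * K"
        by simp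
      have "\<gamma> (\<tau> j) = c (e * x j)"
        using \<tau>[OF j] \<gamma>[of "\<tau> j"] by simp
      \<comment> \<open>A traversal in the opposite direction meets the point with index
        \<open>- (m + int j)\<close>, which has the same parity.\<close>
      moreover have "e * x j = of_int (m + int j) / (2 * real K) \<or>
          e * x j = of_int (- (m + int j)) / (2 * real K)"
        using e by (auto simp: x_def)
      moreover have "even (- (m + int j)) \<longleftrightarrow> even (m + int j)"
        by (rule dvd_minus_iff)
      ultimately show "kind L (\<gamma> (\<tau> j)) = (if even (m + int j) then A else B)"
        using kind by metis
    qed simp
    finally show ?thesis
      unfolding alternating_word_rotation cyclic_class_def by blast
  qed
  ultimately show ?thesis
    using K primitive_pair[OF AB] by (auto simp: has_pattern_def)
qed

section \<open>Gaussian integers and sublattices\<close>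

lemma gauss_ints_0 [simp]: "0 \<in> gauss_ints"
  and gauss_ints_1 [simp]: "1 \<in> gauss_ints"
  and gauss_ints_ii [simp]: "\<i> \<in> gauss_ints"
  and gauss_ints_of_int [simp]: "of_int n \<in> gauss_ints"
  and gauss_ints_of_nat [simp]: "of_nat k \<in> gauss_ints"
  and gauss_ints_add [simp]: "x \<in> gauss_ints \<Longrightarrow> y \<in> gauss_ints \<Longrightarrow> x + y \<in> gauss_ints"
  and gauss_ints_minus [simp]: "x \<in> gauss_ints \<Longrightarrow> - x \<in> gauss_ints"
  and gauss_ints_diff [simp]: "x \<in> gauss_ints \<Longrightarrow> y \<in> gauss_ints \<Longrightarrow> x - y \<in> gauss_ints"
  and gauss_ints_mult [simp]: "x \<in> gauss_ints \<Longrightarrow> y \<in> gauss_ints \<Longrightarrow> x * y \<in> gauss_ints"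
  and gauss_ints_cnj [simp]: "x \<in> gauss_ints \<Longrightarrow> cnj x \<in> gauss_ints"
  by (auto simp: gauss_ints_def)

lemma in_Ints_minus_half: "x - 1/2 \<in> \<int> \<longleftrightarrow> x + 1/2 \<in> \<int>" for x :: real
  using Ints_add[of "x - 1/2" 1] Ints_diff[of "x + 1/2" 1] by (auto simp: add.commute)

lemma norm_gauss_int_ge_1:
  assumes "z \<in> gauss_ints" "z \<noteq> 0"
  shows "norm z \<ge> 1"
proof -
  have "1 \<le> \<bar>Re z\<bar> \<or> 1 \<le> \<bar>Im z\<bar>"
    using assms Ints_nonzero_abs_ge1[of "Re z"] Ints_nonzero_abs_ge1[of "Im z"]
    by (auto simp: gauss_ints_def complex_eq_iff)
  then show ?thesis
    using abs_Re_le_cmod[of z] abs_Im_le_cmod[of z] by linarith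
qed

lemma unit_gauss_ints:
  assumes "z \<in> gauss_ints" "norm z = 1"
  shows "z \<in> {1, -1, \<i>, -\<i>}"
proof -
  obtain m n :: int where mn: "Re z = m" "Im z = n"
    using assms(1) by (auto simp: gauss_ints_def elim!: Ints_cases)
  then have sq: "m\<^sup>2 + n\<^sup>2 = 1"
    using assms(2) by (simp add: norm_complex_def flip: of_int_power of_int_add)
  then have "m\<^sup>2 \<le> 1" "n\<^sup>2 \<le> 1"
    using zero_le_power2[of m] zero_le_power2[of n] by linarith+
  then have "\<bar>m\<bar> \<le> 1" "\<bar>n\<bar> \<le> 1"
    by (simp_all only: abs_square_le_1)
  then have "m \<in> {-1, 0, 1}" "n \<in> {-1, 0, 1}"
    by auto
  then show ?thesis
    using sq mn by (auto simp: complex_eq_iff)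
qed

lemma half_int_in_Ints_iff: "real_of_int j / 2 \<in> \<int> \<longleftrightarrow> even j"
  and half_int_plus_half_in_Ints_iff: "real_of_int j / 2 + 1 / 2 \<in> \<int> \<longleftrightarrow> odd j"
proof -
  have *: "real_of_int k / 2 \<in> \<int> \<longleftrightarrow> even k" for k
  proof
    assume "real_of_int k / 2 \<in> \<int>"
    then obtain n where "real_of_int k / 2 = of_int n"
      by (auto elim: Ints_cases)
    then have "real_of_int k = of_int (2 * n)"
      by simp
    then have "k = 2 * n"
      by (simp only: of_int_eq_iff)
    then show "even k"
      by simp
  qed auto
  from *[of j] show "real_of_int j / 2 \<in> \<int> \<longleftrightarrow> even j" .
  from *[of "j + 1"] show "real_of_int j / 2 + 1 / 2 \<in> \<int> \<longleftrightarrow> odd j"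
    by (simp add: add_divide_distrib)
qed

section \<open>Functions on the torus and lattice coordinates\<close>

text \<open>The universal property of the quotient map. It turns periodic exponentials of the
  lattice coordinates into continuous characters of the torus.\<close>

lemma torus_function_exists:
  fixes h :: "complex \<Rightarrow> complex"
  assumes "continuous_on UNIV h" "\<And>x y. tpoint L x = tpoint L y \<Longrightarrow> h x = h y"
  obtains \<theta> where "continuous_map (torus_topology L) euclidean \<theta>" "\<And>z. \<theta> (tpoint L z) = h z"
  using quotient_map_lift_exists[OF quotient_map_tpoint, of euclidean h L] assms
  by (metis UNIV_I continuous_map_iff_continuous2 topspace_euclidean)

lemma continuous_map_tpoint_line:
  "continuous_map euclidean (torus_topology L) (\<lambda>s. tpoint L (p + complex_of_real s * v))"
proof -
  have "continuous_map euclidean euclidean (\<lambda>s. p + complex_of_real s * v)"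
    unfolding continuous_map_iff_continuous2 by (intro continuous_intros)
  from continuous_map_compose[OF this quotient_imp_continuous_map[OF quotient_map_tpoint]]
  show ?thesis
    by (simp add: o_def)
qed

text \<open>In the applications \<open>v\<close> points along the mirror and \<open>w\<close>
  completes it to a basis of \<open>L\<close>. \<open>Im (cnj v * w)\<close> is the determinant of
  the pair, and a basis of Gaussian integers makes lattice translations preserve the
  tessellation.\<close>

locale gauss_lattice =
  fixes L :: "complex set" and v w :: complex
  assumes L_eq: "L = {of_int m * v + of_int n * w | m n. True}"
    and independent: "Im (cnj v * w) \<noteq> 0"
    and basis_gauss: "v \<in> gauss_ints" "w \<in> gauss_ints"
begin

text \<open>Cramer's rule: \<open>coord1\<close> and \<open>coord2\<close> are the real coordinates
  with respect to the basis \<open>v\<close>, \<open>w\<close>.\<close>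

definition coord1 :: "complex \<Rightarrow> real" where
  "coord1 z = Im (cnj z * w) / Im (cnj v * w)"

definition coord2 :: "complex \<Rightarrow> real" where
  "coord2 z = Im (cnj v * z) / Im (cnj v * w)"

lemma coord_add: "coord1 (x + y) = coord1 x + coord1 y" "coord2 (x + y) = coord2 x + coord2 y"
  and coord_diff: "coord1 (x - y) = coord1 x - coord1 y" "coord2 (x - y) = coord2 x - coord2 y"
  by (simp_all only: coord1_def coord2_def complex_cnj_add complex_cnj_diff ring_distribs
      plus_complex.sel minus_complex.sel add_divide_distrib diff_divide_distrib)

lemma coord_scale: "coord1 (of_real r * x) = r * coord1 x" "coord2 (of_real r * x) = r * coord2 x"
  by (simp_all add: coord1_def coord2_def right_diff_distrib distrib_left mult_ac
      add_divide_distrib diff_divide_distrib)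

lemma coord_basis: "coord1 v = 1" "coord1 w = 0" "coord2 v = 0" "coord2 w = 1"
  using independent by (simp_all add: coord1_def coord2_def)

lemma coord_expansion: "z = of_real (coord1 z) * v + of_real (coord2 z) * w"
proof -
  let ?D = "Im (cnj v * w)"
  have "of_real ?D * z = of_real (Im (cnj z * w)) * v + of_real (Im (cnj v * z)) * w"
    by (simp add: complex_eq_iff algebra_simps)
  also have "Im (cnj z * w) = ?D * coord1 z"
    using independent unfolding coord1_def
    by (metis nonzero_mult_div_cancel_left times_divide_eq_right)
  also have "Im (cnj v * z) = ?D * coord2 z"
    using independent unfolding coord2_def
    by (metis nonzero_mult_div_cancel_left times_divide_eq_right)
  finally have "of_real ?D * z = of_real ?D * (of_real (coord1 z) * v + of_real (coord2 z) * w)"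
    by (simp only: of_real_mult distrib_left mult.assoc)
  then show ?thesis
    using independent by (simp only: mult_cancel_left of_real_eq_0_iff) simp
qed

lemma continuous_coord: "continuous_on A coord1" "continuous_on A coord2"
  using independent unfolding coord1_def[abs_def] coord2_def[abs_def]
  by (auto intro!: continuous_intros)

lemma int_combination_in_L: "of_int m * v + of_int n * w \<in> L"
  by (auto simp: L_eq)

lemma in_L_iff: "z \<in> L \<longleftrightarrow> coord1 z \<in> \<int> \<and> coord2 z \<in> \<int>"
proof
  assume "z \<in> L"
  then obtain m n where z: "z = of_int m * v + of_int n * w"
    by (auto simp: L_eq)
  have "coord1 z = m" "coord2 z = n"
    using coord_scale[of "of_int m" v] coord_scale[of "of_int n" w]
    by (simp_all add: z coord_add coord_basis)
  then show "coord1 z \<in> \<int> \<and> coord2 z \<in> \<int>"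
    by simp
next
  assume "coord1 z \<in> \<int> \<and> coord2 z \<in> \<int>"
  then obtain m n where "coord1 z = of_int m" "coord2 z = of_int n"
    by (auto elim!: Ints_cases)
  then show "z \<in> L"
    using coord_expansion[of z] int_combination_in_L[of m n] by simp
qed

lemma L_add: "x \<in> L \<Longrightarrow> y \<in> L \<Longrightarrow> x + y \<in> L"
  and L_diff: "x \<in> L \<Longrightarrow> y \<in> L \<Longrightarrow> x - y \<in> L"
  by (auto simp: in_L_iff coord_add coord_diff)

lemma L_0: "0 \<in> L"
  using int_combination_in_L[of 0 0] by simp

lemma L_subset_gauss_ints: "L \<subseteq> gauss_ints"
  using basis_gauss by (auto simp: L_eq)

lemma tpoint_eq_iff: "tpoint L x = tpoint L y \<longleftrightarrow> x - y \<in> L"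
proof
  assume "tpoint L x = tpoint L y"
  moreover have "x \<in> tpoint L x"
    by (simp add: tpoint_def L_0)
  ultimately show "x - y \<in> L"
    by (simp add: tpoint_def)
next
  assume xy: "x - y \<in> L"
  show "tpoint L x = tpoint L y"
    unfolding tpoint_def using L_add[OF _ xy] L_diff[OF _ xy] by (auto simp: algebra_simps) force+
qed

text \<open>Distinct elements of \<open>L\<close> differ by a nonzero Gaussian integer, hence by at
  least 1 in norm, so \<open>L\<close> is discrete.\<close>

lemma L_valued_constant:
  assumes "connected S" "continuous_on S h" "\<And>z. z \<in> S \<Longrightarrow> h z \<in> L"
  shows "h constant_on S"
  using assms(1,2)
proof (rule continuous_discrete_range_constant)
  fix x assume x: "x \<in> S"
  have "1 \<le> norm (h y - h x)" if "y \<in> S" "h y \<noteq> h x" for y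
    using that x assms(3) L_diff L_subset_gauss_ints
    by (intro norm_gauss_int_ge_1) (auto dest: subsetD)
  then show "\<exists>e>0. \<forall>y. y \<in> S \<and> h y \<noteq> h x \<longrightarrow> e \<le> norm (h y - h x)"
    by (intro exI[of _ 1]) auto
qed

text \<open>Removing the integer parts of both coordinates moves \<open>z\<close> into the
  fundamental parallelogram. This supplies the bound for Liouville's theorem.\<close>

lemma bounded_representative: "\<exists>l\<in>L. norm (z + l) \<le> norm v + norm w"
proof
  let ?l = "of_int (- \<lfloor>coord1 z\<rfloor>) * v + of_int (- \<lfloor>coord2 z\<rfloor>) * w"
  show "?l \<in> L"
    by (rule int_combination_in_L)
  have "z + ?l = of_real (frac (coord1 z)) * v + of_real (frac (coord2 z)) * w"
    by (subst (1) coord_expansion[of z]) (simp add: frac_def algebra_simps)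
  also have "norm \<dots> \<le> frac (coord1 z) * norm v + frac (coord2 z) * norm w"
    by (rule norm_triangle_le) (simp add: norm_mult)
  also have "\<dots> \<le> norm v + norm w"
    using frac_lt_1[of "coord1 z"] frac_lt_1[of "coord2 z"]
    by (intro add_mono mult_left_le_one_le) (auto intro: less_imp_le)
  finally show "norm (z + ?l) \<le> norm v + norm w" .
qed

section \<open>Affine form of anticonformal maps\<close>

text \<open>Two conjugated local lifts differ by a constant wherever they are compared, even after a
  lattice translation. Their derivatives therefore glue to one entire \<open>L\<close>-periodic
  function, which is bounded and hence constant. The local lifts are then affine in
  \<open>cnj z\<close>, and connectedness of the plane extends one formula everywhere.\<close>

lemma anticonformal_imp_affine:
  assumes "anticonformal L f"
  obtains u c where "\<And>z. f (tpoint L z) = tpoint L (u * cnj z + c)"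
proof -
  obtain r g where r: "\<And>z. r z > 0"
    and hol: "\<And>z. (cnj \<circ> g z) holomorphic_on ball z (r z)"
    and lift: "\<And>z x. x \<in> ball z (r z) \<Longrightarrow> f (tpoint L x) = tpoint L (g z x)"
    using assms unfolding anticonformal_def by metis
  have contg: "continuous_on (ball z (r z)) (g z)" for z
    using continuous_on_cnj[OF holomorphic_on_imp_continuous_on[OF hol[of z]]] by (simp add: o_def)
  have deriv_shift: "deriv (cnj \<circ> g x) z = deriv (cnj \<circ> g y) (z + l)"
    if z: "z \<in> ball x (r x)" "z + l \<in> ball y (r y)" and l: "l \<in> L" for x y z l
  proof -
    \<comment> \<open>\<open>S\<close> is the part of the first ball that translation by
      \<open>l\<close> carries into the second ball. It is convex, so the \<open>L\<close>-valued
      difference of the two lifts is constant on it.\<close>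
    define S where "S = ball x (r x) \<inter> ball (y - l) (r y)"
    have S_y: "s + l \<in> ball y (r y)" if "s \<in> S" for s
      using that by (auto simp: S_def dist_norm algebra_simps)
    have S: "open S" "connected S" "z \<in> S"
      using z by (auto simp: S_def convex_Int convex_connected dist_norm algebra_simps)
    have "(\<lambda>s. g x s - g y (s + l)) constant_on S"
    proof (rule L_valued_constant[OF S(2)])
      show "continuous_on S (\<lambda>s. g x s - g y (s + l))"
        by (intro continuous_intros continuous_on_subset[OF contg] continuous_on_compose2[OF contg[of y]])
          (use S_y in \<open>auto simp: S_def\<close>)
      show "g x s - g y (s + l) \<in> L" if "s \<in> S" for s
      proof -
        have "tpoint L (g x s) = f (tpoint L s)"
          using that lift[of s x] by (simp add: S_def)
        also have "tpoint L s = tpoint L (s + l)"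
          using L_diff[OF L_0 l] by (simp add: tpoint_eq_iff)
        also have "f \<dots> = tpoint L (g y (s + l))"
          by (rule lift[OF S_y[OF that]])
        finally show ?thesis
          by (simp add: tpoint_eq_iff)
      qed
    qed
    then obtain k where k: "\<And>s. s \<in> S \<Longrightarrow> g x s - g y (s + l) = k"
      by (auto simp: constant_on_def)
    have "((cnj \<circ> g y) has_field_derivative deriv (cnj \<circ> g y) (z + l)) (at (z + l))"
      by (rule holomorphic_derivI[OF hol]) (use z in auto)
    then have "((\<lambda>s. (cnj \<circ> g y) (s + l) + cnj k) has_field_derivative
        deriv (cnj \<circ> g y) (z + l)) (at z)"
      using DERIV_add[OF _ DERIV_const] by (fastforce simp only: DERIV_shift add_0_right)
    moreover have "(cnj \<circ> g y) (s + l) + cnj k = (cnj \<circ> g x) s" if "s \<in> S" for s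
      using k[OF that] by (auto simp: algebra_simps)
    ultimately have "((cnj \<circ> g x) has_field_derivative deriv (cnj \<circ> g y) (z + l)) (at z)"
      by (rule has_field_derivative_transform_within_open[OF _ S(1,3)])
    then show ?thesis
      by (rule DERIV_imp_deriv)
  qed
  define D where "D z = deriv (cnj \<circ> g z) z" for z
  \<comment> \<open>The case \<open>l = 0\<close> of \<open>deriv_shift\<close>: the derivative at
    \<open>z\<close> does not depend on the chart, so \<open>D\<close> is holomorphic on every
    ball.\<close>
  have D: "D z = deriv (cnj \<circ> g x) z" if "z \<in> ball x (r x)" for x z
    unfolding D_def using deriv_shift[of z z 0 x] that r L_0 by simp
  have "D holomorphic_on ball x (r x)" for x
    by (rule holomorphic_transform[OF holomorphic_deriv[OF hol[of x] open_ball]]) (simp add: D)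
  then have holD: "D holomorphic_on UNIV"
    using r by (metis centre_in_ball holomorphic_on_imp_differentiable_at holomorphic_onI
        field_differentiable_at_within open_ball)
  \<comment> \<open>By \<open>deriv_shift\<close> for general \<open>l\<close>, \<open>D\<close> is
    periodic, so a compact disc containing a representative of every point already yields all its
    values.\<close>
  have "range D \<subseteq> D ` cball 0 (norm v + norm w)"
  proof
    fix y assume "y \<in> range D"
    then obtain z where y: "y = D z"
      by auto
    obtain l where l: "l \<in> L" "norm (z + l) \<le> norm v + norm w"
      using bounded_representative by blast
    have "y = D (z + l)"
      unfolding y D_def using r l by (intro deriv_shift) auto
    then show "y \<in> D ` cball 0 (norm v + norm w)"
      using l by auto
  qed
  moreover have "compact (D ` cball 0 (norm v + norm w))"
    using holomorphic_on_imp_continuous_on[OF holD]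
    by (intro compact_continuous_image) (auto intro: continuous_on_subset)
  ultimately have "bounded (range D)"
    using bounded_subset compact_imp_bounded by blast
  then obtain k where k: "\<And>z. D z = k"
    using Liouville_theorem[OF holD] by (auto simp: constant_on_def)
  have "\<exists>a. \<forall>z\<in>ball x (r x). (cnj \<circ> g x) z - k * z = a" for x
  proof (rule has_field_derivative_zero_constant)
    fix z assume z: "z \<in> ball x (r x)"
    have "((cnj \<circ> g x) has_field_derivative k) (at z)"
      using holomorphic_derivI[OF hol open_ball z] D[OF z] k by simp
    then have "((\<lambda>z. (cnj \<circ> g x) z - k * z) has_field_derivative k - k * 1) (at z)"
      by (intro DERIV_diff DERIV_cmult DERIV_ident)
    then show "((\<lambda>z. (cnj \<circ> g x) z - k * z) has_field_derivative 0) (at z within ball x (r x))"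
      by (simp add: has_field_derivative_at_within)
  qed simp
  then obtain a where a: "\<And>x z. z \<in> ball x (r x) \<Longrightarrow> cnj (g x z) - k * z = a x"
    unfolding o_def by metis
  have g: "g x z = cnj k * cnj z + cnj (a x)" if "z \<in> ball x (r x)" for x z
    using arg_cong[OF a[OF that], of cnj] by (simp add: algebra_simps)
  \<comment> \<open>On each ball the lift is affine with the common slope \<open>cnj k\<close>, and
    only its constant may vary. Whether that constant agrees with \<open>cnj (a 0)\<close> modulo
    \<open>L\<close> is the same for all points of a ball, so \<open>T\<close> and its complement
    are both open.\<close>
  define T where "T = {z. f (tpoint L z) = tpoint L (cnj k * cnj z + cnj (a 0))}"
  have T_local: "z \<in> T \<longleftrightarrow> cnj (a x) - cnj (a 0) \<in> L" if "z \<in> ball x (r x)" for x z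
    using that by (simp add: T_def lift g tpoint_eq_iff)
  have T_ball: "z \<in> T \<longleftrightarrow> x \<in> T" if "z \<in> ball x (r x)" for x z
    using T_local[OF that] T_local[of x x] r by simp
  have "ball x (r x) \<subseteq> T" if "x \<in> T" for x
    using T_ball that by blast
  moreover have "ball x (r x) \<subseteq> - T" if "x \<in> - T" for x
    using T_ball that by blast
  ultimately have "open T" "open (- T)"
    unfolding open_contains_ball using r by blast+
  moreover have "0 \<in> T"
    using T_local[of 0 0] r L_0 by simp
  ultimately have "T = UNIV"
    using clopen[of T] by (auto simp: closed_def)
  then show ?thesis
    using that[of "cnj k" "cnj (a 0)"] by (auto simp: T_def)
qed

section \<open>Map reflections and their mirrors\<close>

lemma tpoint_in_vertices_iff: "tpoint L z \<in> vertices L \<longleftrightarrow> z \<in> gauss_ints"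
proof
  assume "tpoint L z \<in> vertices L"
  then obtain y where "y \<in> gauss_ints" "z - y \<in> L"
    by (auto simp: vertices_def tpoint_eq_iff)
  then show "z \<in> gauss_ints"
    using L_subset_gauss_ints gauss_ints_add[of y "z - y"] by auto
qed (auto simp: vertices_def)

text \<open>The images of the vertices 0 and 1 show that \<open>c\<close> and \<open>u\<close> are
  Gaussian integers. The square of the reflection is the identity modulo \<open>L\<close>, so
  \<open>(u * cnj u - 1) * z\<close> lies in the discrete set \<open>L\<close> for every
  \<open>z\<close>, which forces \<open>norm u = 1\<close>.\<close>

lemma map_reflection_imp_affine:
  assumes f: "map_reflection L f"
  obtains u c where "u \<in> {1, -1, \<i>, -\<i>}" "c \<in> gauss_ints"
    "\<And>z. f (tpoint L z) = tpoint L (u * cnj z + c)"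
proof -
  obtain u c where uc: "\<And>z. f (tpoint L z) = tpoint L (u * cnj z + c)"
    using f anticonformal_imp_affine unfolding map_reflection_def by metis
  have vert: "u * cnj z + c \<in> gauss_ints" if "z \<in> gauss_ints" for z
  proof -
    have "f ` vertices L = vertices L"
      using f by (simp add: map_reflection_def map_automorphism_def)
    then have "f (tpoint L z) \<in> vertices L"
      using that tpoint_in_vertices_iff by blast
    then show ?thesis
      by (simp add: uc tpoint_in_vertices_iff)
  qed
  have c: "c \<in> gauss_ints"
    using vert[of 0] by simp
  have u: "u \<in> gauss_ints"
    using gauss_ints_diff[OF vert[of 1] c] by simp
  have invol: "u * cnj (u * cnj z + c) + c - z \<in> L" for z
  proof -
    have "f (f (tpoint L z)) = tpoint L z"
      using f by (auto simp: map_reflection_def torus_def)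
    then show ?thesis
      by (simp only: uc tpoint_eq_iff)
  qed
  have "(u * cnj u - 1) * z \<in> L" for z
    using L_diff[OF invol[of z] invol[of 0]] by (simp add: algebra_simps)
  then have *: "(u * cnj u - 1) * z \<in> gauss_ints" for z
    using L_subset_gauss_ints by auto
  have "u * cnj u = 1"
  proof (rule ccontr)
    assume "u * cnj u \<noteq> 1"
    \<comment> \<open>If the factor were nonzero, \<open>z\<close> could be chosen to give the
      product any value, in particular \<open>1/2\<close>.\<close>
    then have "1/2 \<in> gauss_ints"
      using *[of "inverse (u * cnj u - 1) * (1/2)"]
      by (simp only: right_inverse right_minus_eq mult_1 not_False_eq_True flip: mult.assoc)
    then show False
      using norm_gauss_int_ge_1[of "1/2"] by simp
  qed
  then have "complex_of_real ((norm u)\<^sup>2) = of_real 1"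
    unfolding complex_norm_square by simp
  then have "(norm u)\<^sup>2 = 1"
    by (simp only: of_real_eq_iff)
  then have "norm u = 1"
    using norm_ge_zero[of u] by (auto simp: power2_eq_1_iff)
  then show ?thesis
    using that[OF unit_gauss_ints[OF u] c uc] by blast
qed

text \<open>Modulo the direction \<open>v\<close> of the axis the reflection acts as \<open>-1\<close>, so on its fixed points
  the second coordinate takes at most two values modulo \<open>\<int>\<close>.\<close>

lemma mirror_is_line:
  assumes f: "\<And>z. f (tpoint L z) = tpoint L (u * cnj z + c)"
    and v: "u * cnj v = v" and w: "u * cnj w + w = of_real k * v"
    and C: "C \<in> mirrors L f"
  obtains z where "C = range (\<lambda>s. tpoint L (z + of_real s * v))" "u * cnj z + c - z \<in> L"
proof -
  define X where "X = subtopology (torus_topology L) {p \<in> torus L. f p = p}"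
  have C: "C \<in> connected_components_of X"
    using C by (simp add: mirrors_def X_def)
  have "topspace X = {p \<in> torus L. f p = p}"
    by (auto simp: X_def)
  then have C_fixed: "C \<subseteq> {p \<in> torus L. f p = p}"
    using connected_components_of_subset[OF C] by simp
  have fixed: "f (tpoint L z) = tpoint L z \<longleftrightarrow> u * cnj z + c - z \<in> L" for z
    by (simp add: f tpoint_eq_iff)
  obtain z where z: "tpoint L z \<in> C"
    using nonempty_connected_components_of[OF C] C_fixed by (auto simp: torus_def)
  have fix_z: "u * cnj z + c - z \<in> L"
    using z C_fixed fixed by auto
  have "C = range (\<lambda>s. tpoint L (z + of_real s * v))" (is "C = range ?c")
  proof
    have line_fixed: "u * cnj (z + of_real s * v) + c - (z + of_real s * v) = u * cnj z + c - z" for s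
    proof -
      have "u * cnj (of_real s * v) = of_real s * v"
        using v by (simp add: mult.left_commute)
      then show ?thesis
        by (simp add: ring_distribs)
    qed
    have "connectedin (torus_topology L) (range ?c)"
      by (rule connectedin_continuous_map_image[OF continuous_map_tpoint_line])
        (simp add: connected_UNIV)
    moreover have "range ?c \<subseteq> {p \<in> torus L. f p = p}"
      using fix_z unfolding image_subset_iff by (simp only: mem_Collect_eq fixed line_fixed)
        (simp add: torus_def)
    ultimately have "connectedin X (range ?c)"
      by (simp add: X_def connectedin_subtopology)
    moreover have "tpoint L z \<in> range ?c"
      by (rule image_eqI[of _ _ 0]) auto
    ultimately show "range ?c \<subseteq> C"
      using connected_components_of_maximal[OF C] z by (auto simp: disjnt_def)
  next
    \<comment> \<open>This character is constant along the direction \<open>v\<close>, and equality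
      of its values means equality of the second coordinates modulo integers. It thus separates the
      parallel lines on the torus.\<close>
    obtain \<theta> where \<theta>: "continuous_map (torus_topology L) euclidean \<theta>"
        "\<And>x. \<theta> (tpoint L x) = cis (2 * pi * coord2 x)"
    proof (rule torus_function_exists)
      show "continuous_on UNIV (\<lambda>x. cis (2 * pi * coord2 x))"
        by (intro continuous_intros continuous_coord)
      show "cis (2 * pi * coord2 x) = cis (2 * pi * coord2 y)" if "tpoint L x = tpoint L y" for x y
        using that by (simp add: tpoint_eq_iff in_L_iff coord_diff cis_2pi_eq_iff)
    qed blast
    \<comment> \<open>In the basis \<open>v\<close>, \<open>w\<close> the linear part fixes
      \<open>v\<close> and sends \<open>w\<close> to \<open>k * v - w\<close>, so it negates the
      second coordinate.\<close>
    have coord2_refl: "coord2 (u * cnj x) = - coord2 x" for x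
    proof -
      have "u * cnj x = of_real (coord1 x) * (u * cnj v) + of_real (coord2 x) * (u * cnj w)"
        by (subst (1) coord_expansion[of x]) (simp add: algebra_simps)
      also have "u * cnj w = of_real k * v - w"
        using w by (simp add: algebra_simps)
      finally show ?thesis
        by (simp add: v coord_add coord_diff coord_scale coord_basis)
    qed
    have "\<theta> p ^ 2 = cis (2 * pi * coord2 c)" if p: "p \<in> C" for p
    proof -
      obtain x where x: "p = tpoint L x" "u * cnj x + c - x \<in> L"
        using p C_fixed fixed by (auto simp: torus_def)
      then have "coord2 c - 2 * coord2 x \<in> \<int>"
        by (simp add: in_L_iff coord_add coord_diff coord2_refl)
      then have "cis (2 * pi * coord2 c) = cis (2 * pi * (2 * coord2 x))"
        by (simp only: cis_2pi_eq_iff)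
      also have "\<dots> = cis (2 * pi * coord2 x) ^ 2"
        by (simp add: power2_eq_square cis_mult)
      finally show ?thesis
        by (simp add: x \<theta>(2))
    qed
    then have "\<theta> ` C \<subseteq> {y. y ^ 2 = cis (2 * pi * coord2 c)}"
      by auto
    moreover have "{y. y ^ 2 = a} \<subseteq> {csqrt a, - csqrt a}" for a
    proof -
      have "y = csqrt a \<or> y = - csqrt a" if "y ^ 2 = a" for y
        using that power2_eq_iff[of y "csqrt a"] power2_csqrt[of a] by simp
      then show ?thesis
        by blast
    qed
    ultimately have "finite (\<theta> ` C)"
      by (meson finite.intros finite_subset subset_trans)
    moreover have "connected (\<theta> ` C)"
    proof -
      have "connectedin (torus_topology L) C"
        using connectedin_connected_components_of[OF C] by (simp add: X_def connectedin_subtopology)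
      from connectedin_continuous_map_image[OF \<theta>(1) this] show ?thesis
        by simp
    qed
    \<comment> \<open>\<open>C\<close> is connected and \<open>\<theta>\<close> takes at most two
      values on it, so it takes just one.\<close>
    ultimately have const: "\<theta> p = \<theta> (tpoint L z)" if "p \<in> C" for p
      using connected_finite_iff_sing[of "\<theta> ` C"] that z by (metis empty_iff image_eqI singletonD)
    show "C \<subseteq> range ?c"
    proof
      fix p assume p: "p \<in> C"
      then obtain x where x: "p = tpoint L x"
        using C_fixed by (auto simp: torus_def)
      have "coord2 x - coord2 z \<in> \<int>"
        using const[OF p] by (simp add: x \<theta>(2) cis_2pi_eq_iff)
      \<comment> \<open>The second coordinates agree modulo integers; sliding along \<open>v\<close>
        by the difference of the first coordinates cancels the rest modulo \<open>L\<close>.\<close>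
      then have "x - (z + of_real (coord1 x - coord1 z) * v) \<in> L"
        by (simp add: in_L_iff coord_add coord_diff coord_scale coord_basis flip: of_real_diff)
      then show "p \<in> range ?c"
        unfolding x tpoint_eq_iff[symmetric] by (rule range_eqI)
    qed
  qed
  then show ?thesis
    using that fix_z by blast
qed

section \<open>Geometric points and patterns along lines\<close>

text \<open>Subtracting half an edge vector turns an edge-centre into a vertex, and adding elements
  of \<open>L\<close> does not affect integrality of the coordinates. \<open>P2\<close> is the
  default value of \<open>kind\<close>, so the last case covers all remaining points, geometric or
  not.\<close>

lemma kind_tpoint:
  "kind L (tpoint L z) =
    (if Re z \<in> \<int> \<and> Im z \<in> \<int> then P0
     else if Re z + 1/2 \<in> \<int> \<and> Im z \<in> \<int> \<or> Re z \<in> \<int> \<and> Im z + 1/2 \<in> \<int> then P1 else P2)"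
  (is "_ = (if _ then _ else if ?e then _ else _)")
proof -
  have "tpoint L z \<in> edge_centres L \<longleftrightarrow>
      (\<exists>u\<in>{1, \<i>}. z - u / 2 \<in> gauss_ints)"
  proof
    assume "tpoint L z \<in> edge_centres L"
    then obtain y u where yu: "y \<in> gauss_ints" "u \<in> {1, \<i>}" "z - midpoint y (y + u) \<in> L"
      by (auto simp: edge_centres_def tpoint_eq_iff)
    have "z - u / 2 = y + (z - midpoint y (y + u))"
      by (simp add: midpoint_def scaleR_conv_of_real field_simps)
    also have "\<dots> \<in> gauss_ints"
      using yu L_subset_gauss_ints by auto
    finally show "\<exists>u\<in>{1, \<i>}. z - u / 2 \<in> gauss_ints"
      using yu by blast
  next
    assume "\<exists>u\<in>{1, \<i>}. z - u / 2 \<in> gauss_ints"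
    then obtain u where u: "u \<in> {1, \<i>}" "z - u / 2 \<in> gauss_ints"
      by blast
    moreover have "z = midpoint (z - u / 2) (z - u / 2 + u)"
      by (simp add: midpoint_def scaleR_conv_of_real field_simps)
    ultimately show "tpoint L z \<in> edge_centres L"
      unfolding edge_centres_def mem_Collect_eq by metis
  qed
  also have "\<dots> \<longleftrightarrow> ?e"
    by (simp add: gauss_ints_def in_Ints_minus_half)
  finally show ?thesis
    unfolding kind_def tpoint_in_vertices_iff by (simp only: gauss_ints_def mem_Collect_eq)
qed

text \<open>The four classes of half Gaussian integers modulo Gaussian integers are the vertices,
  the two kinds of edge-centres and the face-centres.\<close>

lemma geometric_points_tpoint:
  "tpoint L z \<in> geometric_points L \<longleftrightarrow> 2 * z \<in> gauss_ints"
proof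
  have L2: "2 * z \<in> gauss_ints" if "z - y \<in> L" "2 * y \<in> gauss_ints" for y
  proof -
    have "2 * z = 2 * y + (z - y) + (z - y)"
      by simp
    also have "\<dots> \<in> gauss_ints"
      using that L_subset_gauss_ints by (intro gauss_ints_add) auto
    finally show ?thesis .
  qed
  assume "tpoint L z \<in> geometric_points L"
  then obtain y u where yu: "y \<in> gauss_ints" "u \<in> gauss_ints"
      "tpoint L z = tpoint L y \<or> tpoint L z = tpoint L (midpoint y (y + u))"
    unfolding geometric_points_def vertices_def edge_centres_def face_centres_def
    by (auto intro: that[OF _ gauss_ints_1] that[OF _ gauss_ints_ii]
        that[OF _ gauss_ints_add[OF gauss_ints_1 gauss_ints_ii]])
  have "2 * midpoint y (y + u) = y + y + u"
    by (simp add: midpoint_def scaleR_conv_of_real)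
  then have "2 * y \<in> gauss_ints" "2 * midpoint y (y + u) \<in> gauss_ints"
    using yu(1,2) by (simp_all only: mult_2 gauss_ints_add)
  then show "2 * z \<in> gauss_ints"
    using yu(3) L2 by (auto simp: tpoint_eq_iff)
next
  assume z: "2 * z \<in> gauss_ints"
  then obtain m n :: int where mn: "2 * Re z = m" "2 * Im z = n"
    by (auto simp: gauss_ints_def elim!: Ints_cases)
  \<comment> \<open>\<open>y\<close> is the lower left corner of a unit square containing
    \<open>z\<close>; the parities of \<open>m\<close> and \<open>n\<close> select one of the four
    classes.\<close>
  define y where "y = Complex (m div 2) (n div 2)"
  have y: "y \<in> gauss_ints"
    by (simp add: y_def gauss_ints_def)
  have half: "x = of_int (k div 2) + of_int (k mod 2) / 2" if "2 * x = of_int k" for x :: real and k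
  proof -
    have "real_of_int k = of_int (2 * (k div 2) + k mod 2)"
      by (simp only: mult_div_mod_eq)
    then show ?thesis
      using that unfolding of_int_add of_int_mult of_int_numeral by linarith
  qed
  have "z = y + Complex (m mod 2) (n mod 2) / 2"
    using half[OF mn(1)] half[OF mn(2)] by (simp add: complex_eq_iff y_def)
  moreover have "m mod 2 = 0 \<or> m mod 2 = 1" "n mod 2 = 0 \<or> n mod 2 = 1"
    by auto
  ultimately consider "z = y" | "z = y + 1 / 2" | "z = y + \<i> / 2" | "z = y + (1 + \<i>) / 2"
    by (auto simp: complex_eq_iff)
  moreover have "midpoint y (y + u) = y + u / 2" for u
    by (simp add: midpoint_def scaleR_conv_of_real field_simps)
  then have "tpoint L (y + 1 / 2) \<in> edge_centres L" "tpoint L (y + \<i> / 2) \<in> edge_centres L"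
      "tpoint L (y + (1 + \<i>) / 2) \<in> face_centres L"
    using y unfolding edge_centres_def face_centres_def mem_Collect_eq by (metis insertCI)+
  ultimately show "tpoint L z \<in> geometric_points L"
    using y by cases (simp_all add: geometric_points_def vertices_def)
qed

text \<open>The hypothesis on \<open>d\<close> says that it is a primitive Gaussian vector. Starting
  from the geometric point \<open>p\<close>, the line therefore meets geometric points exactly at
  steps of \<open>d / 2\<close>, and closing up after \<open>K * d\<close> gives
  \<open>2 * K\<close> of them. The character of the first coordinate, centred at \<open>p\<close>,
  identifies the line with the unit circle.\<close>

lemma line_has_pattern:
  assumes v: "v = of_nat K * d" and K: "K > 0" and AB: "A \<noteq> B"
    and p: "2 * p \<in> gauss_ints"
    and d: "\<And>r. of_real r * d \<in> gauss_ints \<longleftrightarrow> r \<in> \<int>"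
    and kind: "\<And>j::int. kind L (tpoint L (p + of_real (j / 2) * d)) = (if even j then A else B)"
  shows "has_pattern L (range (\<lambda>s. tpoint L (p + of_real s * v))) [A, B] K"
proof -
  let ?c = "\<lambda>s. tpoint L (p + of_real s * v)"
  obtain \<omega> where \<omega>: "continuous_map (torus_topology L) euclidean \<omega>"
      "\<And>x. \<omega> (tpoint L x) = cis (2 * pi * coord1 (x - p))"
  proof (rule torus_function_exists)
    show "continuous_on UNIV (\<lambda>x. cis (2 * pi * coord1 (x - p)))"
      unfolding coord_diff by (intro continuous_intros continuous_coord)
    show "cis (2 * pi * coord1 (x - p)) = cis (2 * pi * coord1 (y - p))"
      if "tpoint L x = tpoint L y" for x y
      using that by (simp add: tpoint_eq_iff in_L_iff coord_diff cis_2pi_eq_iff)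
  qed blast
  show ?thesis
  proof (rule has_pattern_alternating[OF K AB \<omega>(1) _ continuous_map_tpoint_line])
    show "\<omega> (?c s) = cis (2 * pi * s)" for s
      by (simp add: \<omega>(2) coord_scale coord_basis)
    show "?c s = ?c t" if "s - t \<in> \<int>" for s t
      using that unfolding tpoint_eq_iff in_L_iff
      by (simp add: coord_add coord_diff coord_scale coord_basis)
    show "?c s \<in> geometric_points L \<longleftrightarrow> 2 * real K * s \<in> \<int>" for s
    proof -
      have eq: "2 * (p + of_real s * v) = 2 * p + of_real (2 * real K * s) * d"
        by (simp add: v algebra_simps)
      have "2 * p + x \<in> gauss_ints \<longleftrightarrow> x \<in> gauss_ints" for x
        using gauss_ints_add[OF p, of x] gauss_ints_diff[OF _ p, of "2 * p + x"] by auto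
      then show ?thesis
        unfolding geometric_points_tpoint eq by (simp only: d)
    qed
    show "kind L (?c (of_int j / (2 * real K))) = (if even j then A else B)" for j :: int
    proof -
      have "of_real (of_int j / (2 * real K)) * v = of_real (of_int j / 2) * d"
        using K by (simp add: v)
      then show ?thesis
        using kind[of j] by (simp only:)
    qed
  qed
qed

lemma range_line_shift:
  assumes "z = p + of_real t * v"
  shows "range (\<lambda>s. tpoint L (z + of_real s * v)) = range (\<lambda>s. tpoint L (p + of_real s * v))"
proof -
  have eq: "z + of_real s * v = p + of_real (t + s) * v" for s
    by (simp add: assms algebra_simps)
  have "range (\<lambda>s. tpoint L (z + of_real s * v)) =
      (\<lambda>s. tpoint L (p + of_real s * v)) ` range ((+) t)"
    unfolding eq by (simp only: image_image)
  then show ?thesis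
    by simp
qed

text \<open>The fixed point equation makes twice the coordinate perpendicular to the mirror an
  integer \<open>m\<close>. For even \<open>m\<close> the line runs along edges through vertices and
  edge-centres; for odd \<open>m\<close> it runs through edge-centres and face-centres.\<close>

lemma axis_mirror_pattern:
  assumes f: "\<And>z. f (tpoint L z) = tpoint L (u * cnj z + c)" and c: "c \<in> gauss_ints"
    and d: "d = 1 \<and> u = 1 \<or> d = \<i> \<and> u = -1"
    and v: "v = of_nat K * d" and K: "K > 0" and w: "u * cnj w + w = of_real k * v"
    and C: "C \<in> mirrors L f"
  shows "has_pattern L C [P0, P1] K \<or> has_pattern L C [P1, P2] K"
proof -
  have "u * cnj v = v"
    using d by (auto simp: v)
  from mirror_is_line[OF f this w C]
  obtain z where C: "C = range (\<lambda>s. tpoint L (z + of_real s * v))" and z: "u * cnj z + c - z \<in> L"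
    by blast
  have z: "u * cnj z - z \<in> gauss_ints"
    using gauss_ints_diff[of "u * cnj z + c - z" c] z c L_subset_gauss_ints by auto
  have dr: "of_real r * d \<in> gauss_ints \<longleftrightarrow> r \<in> \<int>" for r
    using d by (auto simp: gauss_ints_def)
  \<comment> \<open>\<open>p\<close> is the point of the line over the origin, with coordinate 0
    along \<open>d\<close>; it serves as a geometric base point.\<close>
  obtain p t m where p: "z = p + of_real t * v" and
    m: "p = of_real (of_int m / 2) * (if d = 1 then \<i> else 1)"
  proof (cases "d = 1")
    case True
    then have "Im z + Im z \<in> \<int>"
      using z d Ints_minus[of "- Im z - Im z"] by (auto simp: gauss_ints_def complex_eq_iff)
    then obtain m where "Im z + Im z = of_int m"
      by (blast elim: Ints_cases)
    then have "Im z = of_int m / 2"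
      by simp
    then show ?thesis
      using that[of "of_real (of_int m / 2) * \<i>" "Re z / K" m] True K by (simp add: v complex_eq_iff)
  next
    case False
    then have "d = \<i>"
      using d by blast
    have "Re z + Re z \<in> \<int>"
      using False z d Ints_minus[of "- Re z - Re z"] by (auto simp: gauss_ints_def complex_eq_iff)
    then obtain m where "Re z + Re z = of_int m"
      by (blast elim: Ints_cases)
    then have "Re z = of_int m / 2"
      by simp
    then show ?thesis
      using that[of "of_real (of_int m / 2)" "Im z / K" m] K
      by (simp add: v \<open>d = \<i>\<close>) (simp add: complex_eq_iff)
  qed
  have p2: "2 * p \<in> gauss_ints"
    by (auto simp: m gauss_ints_def)
  have C: "C = range (\<lambda>s. tpoint L (p + of_real s * v))"
    unfolding C by (rule range_line_shift[OF p])
  show ?thesis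
  proof (cases "even m")
    case True
    have "kind L (tpoint L (p + of_real (of_int j / 2) * d)) = (if even j then P0 else P1)" for j :: int
      using d True unfolding kind_tpoint
      by (auto simp: m half_int_in_Ints_iff half_int_plus_half_in_Ints_iff)
    then show ?thesis
      unfolding C using line_has_pattern[OF v K _ p2 dr, of P0 P1] by simp
  next
    case False
    have "kind L (tpoint L (p + of_real (of_int j / 2) * d)) = (if even j then P1 else P2)" for j :: int
      using d False unfolding kind_tpoint
      by (auto simp: m half_int_in_Ints_iff half_int_plus_half_in_Ints_iff)
    then show ?thesis
      unfolding C using line_has_pattern[OF v K _ p2 dr, of P1 P2] by simp
  qed
qed

text \<open>Here the fixed point equation makes the intercept of the line with the imaginary axis an
  integer, so the line always passes through vertices. At steps of \<open>d / 2\<close> both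
  coordinates are integers or both are half-odd, so edge-centres are never met and only one pattern
  remains.\<close>

lemma diagonal_mirror_pattern:
  assumes f: "\<And>z. f (tpoint L z) = tpoint L (u * cnj z + c)" and c: "c \<in> gauss_ints"
    and d: "d = 1 + \<i> \<and> u = \<i> \<or> d = 1 - \<i> \<and> u = -\<i>"
    and v: "v = of_nat K * d" and K: "K > 0" and w: "u * cnj w + w = of_real k * v"
    and C: "C \<in> mirrors L f"
  shows "has_pattern L C [P0, P2] K"
proof -
  have "u * cnj v = v"
    using d by (auto simp: v complex_eq_iff)
  from mirror_is_line[OF f this w C]
  obtain z where C: "C = range (\<lambda>s. tpoint L (z + of_real s * v))" and z: "u * cnj z + c - z \<in> L"
    by blast
  have z: "u * cnj z - z \<in> gauss_ints"
    using gauss_ints_diff[of "u * cnj z + c - z" c] z c L_subset_gauss_ints by auto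
  have dr: "of_real r * d \<in> gauss_ints \<longleftrightarrow> r \<in> \<int>" for r
    using d by (auto simp: gauss_ints_def)
  define p where "p = of_real (Im z - Im d * Re z) * \<i>"
  have "Im z - Im d * Re z \<in> \<int>"
    using z d Ints_minus[of "- Re z - Im z"] by (auto simp: gauss_ints_def add.commute)
  then obtain m where m: "Im z - Im d * Re z = of_int m"
    by (auto elim: Ints_cases)
  have p: "z = p + of_real (Re z / K) * v"
    using d K by (auto simp: p_def v complex_eq_iff)
  have p2: "2 * p \<in> gauss_ints"
    by (auto simp: p_def m gauss_ints_def)
  have "kind L (tpoint L (p + of_real (of_int j / 2) * d)) = (if even j then P0 else P2)" for j :: int
  proof -
    \<comment> \<open>Both coordinates are brought to the form integer over 2; the numerators
      \<open>2 * m + j\<close> and \<open>2 * m - j\<close> have the parity of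
      \<open>j\<close>.\<close>
    have "Re (p + of_real (of_int j / 2) * d) = of_int j / 2"
        "Im (p + of_real (of_int j / 2) * d) = of_int (2 * m + j) / 2 \<or>
         Im (p + of_real (of_int j / 2) * d) = of_int (2 * m - j) / 2"
      using d by (auto simp: p_def m add_divide_distrib diff_divide_distrib)
    then show ?thesis
      unfolding kind_tpoint
      by (elim disjE) (simp_all only: half_int_in_Ints_iff half_int_plus_half_in_Ints_iff, simp_all)
  qed
  then show ?thesis
    unfolding C range_line_shift[OF p] using line_has_pattern[OF v K _ p2 dr, of P0 P2] by simp
qed

end

text \<open>Cramer's rule: the determinant \<open>\<plusminus>1\<close> keeps the coefficients integral.\<close>

lemma gauss_lattice_scaled:
  assumes a: "a \<noteq> 0" "a \<in> gauss_ints" and gauss: "x \<in> gauss_ints" "y \<in> gauss_ints"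
    and det: "Im (cnj x * y) = 1 \<or> Im (cnj x * y) = -1"
  shows "gauss_lattice ((\<lambda>z. a * z) ` gauss_ints) (a * x) (a * y)"
proof
  have "\<exists>m n. z = of_int m * x + of_int n * y" if z: "z \<in> gauss_ints" for z
  proof -
    let ?D = "Im (cnj x * y)"
    have "of_real ?D * z = of_real (Im (cnj z * y)) * x + of_real (Im (cnj x * z)) * y"
      by (simp add: complex_eq_iff algebra_simps)
    moreover obtain m n where "Im (cnj z * y) = of_int m" "Im (cnj x * z) = of_int n"
      using gauss_ints_mult[OF gauss_ints_cnj[OF z] gauss(2)]
        gauss_ints_mult[OF gauss_ints_cnj[OF gauss(1)] z]
      unfolding gauss_ints_def by (blast elim: Ints_cases)
    ultimately have eq: "of_real ?D * z = of_int m * x + of_int n * y"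
      by (simp only: of_real_of_int_eq)
    from det show ?thesis
    proof
      assume "?D = 1"
      then show ?thesis
        using eq by (metis mult_1 of_real_1)
    next
      assume "?D = -1"
      then have "- z = of_int m * x + of_int n * y"
        using eq by (metis mult_minus1 of_real_1 of_real_minus)
      then have "z = of_int (- m) * x + of_int (- n) * y"
        by (simp add: minus_equation_iff[of z])
      then show ?thesis
        by blast
    qed
  qed
  moreover have "of_int m * x + of_int n * y \<in> gauss_ints" for m n
    using gauss by simp
  ultimately have *: "gauss_ints = {of_int m * x + of_int n * y | m n. True}"
    by blast
  have "(\<lambda>z. a * z) ` gauss_ints = {a * (of_int m * x + of_int n * y) | m n. True}"
    by (subst *) blast
  also have "\<dots> = {of_int m * (a * x) + of_int n * (a * y) | m n. True}"
    by (simp only: distrib_left mult.left_commute)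
  finally show "(\<lambda>z. a * z) ` gauss_ints = {of_int m * (a * x) + of_int n * (a * y) | m n. True}" .
  have "cnj (a * x) * (a * y) = of_real ((norm a)\<^sup>2) * (cnj x * y)"
    unfolding complex_norm_square by (simp add: mult_ac)
  then have "Im (cnj (a * x) * (a * y)) = (norm a)\<^sup>2 * Im (cnj x * y)"
    by (simp only: Im_complex_of_real Re_complex_of_real times_complex.sel)
  then show "Im (cnj (a * x) * (a * y)) \<noteq> 0"
    using a det by (metis mult_eq_0_iff norm_eq_zero power_eq_0_iff zero_neq_one neg_equal_0_iff_equal)
  show "a * x \<in> gauss_ints" "a * y \<in> gauss_ints"
    using a gauss by auto
qed

section \<open>The two families of tori\<close>

text \<open>The same lattice is given four bases, one for each \<open>u\<close>, whose first vector
  is \<open>b\<close> times the mirror direction \<open>1\<close>, \<open>\<i>\<close>,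
  \<open>1 + \<i>\<close> or \<open>1 - \<i>\<close>. Hence the link index is \<open>b\<close> in
  every case.\<close>

lemma lattice_b0_mirror_patterns:
  assumes b: "b > 0" and f: "map_reflection (lattice_b0 b) f" and C: "C \<in> mirrors (lattice_b0 b) f"
  shows "has_pattern (lattice_b0 b) C [P0, P1] b \<or> has_pattern (lattice_b0 b) C [P0, P2] b \<or>
    has_pattern (lattice_b0 b) C [P1, P2] b"
proof -
  have lattice: "gauss_lattice (lattice_b0 b) (of_nat b * x) (of_nat b * y)"
    if "x \<in> gauss_ints" "y \<in> gauss_ints" "Im (cnj x * y) = 1 \<or> Im (cnj x * y) = -1" for x y
    unfolding lattice_b0_def using b that by (intro gauss_lattice_scaled) auto
  have lat1: "gauss_lattice (lattice_b0 b) (of_nat b * 1) (of_nat b * \<i>)"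
    by (rule lattice) auto
  have lat2: "gauss_lattice (lattice_b0 b) (of_nat b * \<i>) (of_nat b * 1)"
    by (rule lattice) auto
  have lat3: "gauss_lattice (lattice_b0 b) (of_nat b * (1 + \<i>)) (of_nat b * 1)"
    by (rule lattice) auto
  have lat4: "gauss_lattice (lattice_b0 b) (of_nat b * (1 - \<i>)) (of_nat b * 1)"
    by (rule lattice) auto
  obtain u c where u: "u \<in> {1, -1, \<i>, -\<i>}" and c: "c \<in> gauss_ints"
    and f: "\<And>z. f (tpoint (lattice_b0 b) z) = tpoint (lattice_b0 b) (u * cnj z + c)"
    using gauss_lattice.map_reflection_imp_affine[OF lat1 f] by metis
  consider "u = 1" | "u = -1" | "u = \<i>" | "u = -\<i>"
    using u by blast
  then show ?thesis
  proof cases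
    case 1
    then show ?thesis
      using gauss_lattice.axis_mirror_pattern[OF lat1 f c, of 1 b 0] b C by auto
  next
    case 2
    then show ?thesis
      using gauss_lattice.axis_mirror_pattern[OF lat2 f c, of \<i> b 0] b C by auto
  next
    case 3
    then show ?thesis
      using gauss_lattice.diagonal_mirror_pattern[OF lat3 f c, of "1 + \<i>" b 1] b C
      by (simp add: algebra_simps)
  next
    case 4
    then show ?thesis
      using gauss_lattice.diagonal_mirror_pattern[OF lat4 f c, of "1 - \<i>" b 1] b C
      by (simp add: algebra_simps)
  qed
qed

text \<open>With \<open>a = b * (1 + \<i>)\<close>, the basis vectors along the axes are
  \<open>a * (1 - \<i>) = 2 * b\<close> and \<open>a * (1 + \<i>) = 2 * b * \<i>\<close>, while
  along the diagonals they are \<open>a\<close> and \<open>a * - \<i> = b * (1 - \<i>)\<close>. This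
  is why axis mirrors have link index \<open>2 * b\<close> and diagonal ones
  \<open>b\<close>.\<close>

lemma lattice_bb_mirror_patterns:
  assumes b: "b > 0" and f: "map_reflection (lattice_bb b) f" and C: "C \<in> mirrors (lattice_bb b) f"
  shows "has_pattern (lattice_bb b) C [P0, P1] (2 * b) \<or> has_pattern (lattice_bb b) C [P0, P2] b \<or>
    has_pattern (lattice_bb b) C [P1, P2] (2 * b)"
proof -
  define a where "a = of_nat b + of_nat b * \<i>"
  have lattice: "gauss_lattice (lattice_bb b) (a * x) (a * y)"
    if "x \<in> gauss_ints" "y \<in> gauss_ints" "Im (cnj x * y) = 1 \<or> Im (cnj x * y) = -1" for x y
    unfolding lattice_bb_def a_def
    using b that by (intro gauss_lattice_scaled) (auto simp: complex_eq_iff)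
  have lat1: "gauss_lattice (lattice_bb b) (a * (1 - \<i>)) (a * 1)"
    by (rule lattice) auto
  have lat2: "gauss_lattice (lattice_bb b) (a * (1 + \<i>)) (a * 1)"
    by (rule lattice) auto
  have lat3: "gauss_lattice (lattice_bb b) (a * 1) (a * \<i>)"
    by (rule lattice) auto
  have lat4: "gauss_lattice (lattice_bb b) (a * - \<i>) (a * 1)"
    by (rule lattice) auto
  obtain u c where u: "u \<in> {1, -1, \<i>, -\<i>}" and c: "c \<in> gauss_ints"
    and f: "\<And>z. f (tpoint (lattice_bb b) z) = tpoint (lattice_bb b) (u * cnj z + c)"
    using gauss_lattice.map_reflection_imp_affine[OF lat1 f] by metis
  consider "u = 1" | "u = -1" | "u = \<i>" | "u = -\<i>"
    using u by blast
  then show ?thesis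
  proof cases
    case 1
    have "has_pattern (lattice_bb b) C [P0, P1] (2 * b) \<or> has_pattern (lattice_bb b) C [P1, P2] (2 * b)"
      by (rule gauss_lattice.axis_mirror_pattern[OF lat1 f c, of 1 _ 1])
        (use 1 b C in \<open>auto simp: a_def complex_eq_iff\<close>)
    then show ?thesis
      by blast
  next
    case 2
    have "has_pattern (lattice_bb b) C [P0, P1] (2 * b) \<or> has_pattern (lattice_bb b) C [P1, P2] (2 * b)"
      by (rule gauss_lattice.axis_mirror_pattern[OF lat2 f c, of \<i> _ 1])
        (use 2 b C in \<open>auto simp: a_def complex_eq_iff\<close>)
    then show ?thesis
      by blast
  next
    case 3
    have "has_pattern (lattice_bb b) C [P0, P2] b"
      by (rule gauss_lattice.diagonal_mirror_pattern[OF lat3 f c, of "1 + \<i>" _ 0])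
        (use 3 b C in \<open>auto simp: a_def complex_eq_iff\<close>)
    then show ?thesis
      by blast
  next
    case 4
    have "has_pattern (lattice_bb b) C [P0, P2] b"
      by (rule gauss_lattice.diagonal_mirror_pattern[OF lat4 f c, of "1 - \<i>" _ 0])
        (use 4 b C in \<open>auto simp: a_def complex_eq_iff\<close>)
    then show ?thesis
      by blast
  qed
qed

theorem theorem4p1:
  fixes b :: nat
  assumes "b > 0"
  shows "(\<forall>f C. map_reflection (lattice_b0 b) f \<longrightarrow> C \<in> mirrors (lattice_b0 b) f \<longrightarrow>
            has_pattern (lattice_b0 b) C [P0, P1] b \<or>
            has_pattern (lattice_b0 b) C [P0, P2] b \<or>
            has_pattern (lattice_b0 b) C [P1, P2] b)
       \<and> (\<forall>f C. map_reflection (lattice_bb b) f \<longrightarrow> C \<in> mirrors (lattice_bb b) f \<longrightarrow>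
            has_pattern (lattice_bb b) C [P0, P1] (2 * b) \<or>
            has_pattern (lattice_bb b) C [P0, P2] b \<or>
            has_pattern (lattice_bb b) C [P1, P2] (2 * b))"
  using lattice_b0_mirror_patterns[OF assms] lattice_bb_mirror_patterns[OF assms] by blast

end
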